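(* Assume that there is $\epsilon>0$ such that for all $i,l$, $\tilde f_{i;\mathrm{res}}(x)=O(\kappa(x)^{-(1+\epsilon)})$ and $\frac{\partial\tilde f_{i;\mathrm{res}}}{\partial x_l}(x)=o(\kappa(x)^{-(1+\epsilon)})$ as $x\in\mathcal{D}$ approaches $\mathcal{E}$. Let $x_\ast\in\mathcal{E}$ be an equilibrium on the horizon for the desingularized vector field $g$, with $C_\ast:=G(x_\ast)>0$. Then the Jacobian matrix $Dg(x_\ast)$ always possesses the eigenpair $\{-C_\ast,v_{\ast,\alpha}\}$, where $v_{\ast,\alpha}=\Lambda_\alpha x_\ast$; that is, $v_{\ast,\alpha}\neq0$ and $Dg(x_\ast)v_{\ast,\alpha}=-C_\ast v_{\ast,\alpha}$.
   Context: Let $n\ge1$, $\alpha=(\alpha_1,\ldots,\alpha_n)$ positive integers, $k>0$ real, $\Lambda_\alpha=\mathrm{diag}(\alpha_1,\ldots,\alpha_n)$, and $s^{\Lambda_\alpha}=\mathrm{diag}(s^{\alpha_1},\ldots,s^{\alpha_n})$ for $s>0$. The map $f:\mathbb{R}^n\to\mathbb{R}^n$ is $C^r$ with $r\ge2$ and is asymptotically quasi-homogeneous of type $\alpha$ and order $k+1$ at infinity: there is a quasi-homogeneous vector field $f_{\alpha,k}$, i.e. $f_{i;\alpha,k}(s^{\Lambda_\alpha}x)=s^{k+\alpha_i}f_{i;\alpha,k}(x)$ for all $x\in\mathbb{R}^n$, $s>0$, such that $f_i(s^{\Lambda_\alpha}x)-s^{k+\alpha_i}f_{i;\alpha,k}(x)=o(s^{k+\alpha_i})$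 as $s\to+\infty$, uniformly for $x$ in the unit sphere. $f_{\alpha,k}$ is $C^1$. Put $f_{\mathrm{res}}=f-f_{\alpha,k}$. Quasi-parabolic compactification: $c$ is the least common multiple of $\alpha_1,\ldots,\alpha_n$, $\beta_i=c/\alpha_i$, $p(x)=\big(\sum_i x_i^{2\beta_i}\big)^{1/(2c)}$, $\mathcal{D}=\{p<1\}$, horizon $\mathcal{E}=\{p=1\}$, $\overline{\mathcal{D}}=\{p\le1\}$, $\kappa(x)=(1-p(x)^{2c})^{-1}$ on $\mathcal D$. On $\mathcal{D}$ put $\tilde f_i(x)=\kappa^{-(k+\alpha_i)}f_i(\kappa^{\Lambda_\alpha}x)$ and $\tilde f_{i;\mathrm{res}}(x)=\kappa^{-(k+\alpha_i)}f_{i;\mathrm{res}}(\kappa^{\Lambda_\alpha}x)$; $\tilde f$ is extended continuously to $\mathcal{E}$ by $\tilde f=f_{\alpha,k}$. Put $G(x)=\sum_j\frac{x_j^{2\beta_j-1}}{\alpha_j}\tilde f_j(x)$. The desingularized vector field on $\overline{\mathcal{D}}$ is $$g(x)=\Big(1-\tfrac{2c-1}{2c}(1-p(x)^{2c})\Big)\tilde f(x)-G(x)\Lambda_\alpha x .$$ Derivatives at points of $\mathcal{E}$ are continuous extensions of the derivatives from $\mathcal{D}$. An equilibrium on the horizon is $x_\ast\in\mathcal{E}$ with $g(x_\ast)=0$. *)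

theory Defs
  imports "HOL-Analysis.Analysis"
begin

text \<open>A type \<open>\<alpha>\<close> is a family of exponents \<open>\<alpha> :: 'n \<Rightarrow> nat\<close> over the finite index type \<open>'n\<close>
  of the phase space \<open>real ^ 'n\<close>; positivity of the exponents is assumed where it is needed.\<close>

primrec Ck :: "nat \<Rightarrow> ('a::euclidean_space \<Rightarrow> 'b::real_normed_vector) \<Rightarrow> bool" where
  "Ck 0 f \<longleftrightarrow> continuous_on UNIV f"
| "Ck (Suc r) f \<longleftrightarrow>
     (\<forall>x. f differentiable (at x)) \<and> (\<forall>v. Ck r (\<lambda>x. frechet_derivative f (at x) v))"

definition diag_matrix :: "('n \<Rightarrow> real) \<Rightarrow> real ^ 'n ^ 'n" where
  "diag_matrix d = (\<chi> i j. if i = j then d i else 0)"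

definition Lam :: "('n \<Rightarrow> nat) \<Rightarrow> real ^ 'n ^ 'n" where
  "Lam \<alpha> = diag_matrix (\<lambda>i. real (\<alpha> i))"

text \<open>\<open>qscale \<alpha> s\<close> is the matrix power \<open>s\<close> to the \<open>Lam \<alpha>\<close>.\<close>

definition qscale :: "('n \<Rightarrow> nat) \<Rightarrow> real \<Rightarrow> real ^ 'n ^ 'n" where
  "qscale \<alpha> s = diag_matrix (\<lambda>i. s ^ \<alpha> i)"

text \<open>The \<open>k\<close> in the next two definitions corresponds to order \<open>k + 1\<close>.\<close>

definition quasi_homogeneous ::
  "('n::finite \<Rightarrow> nat) \<Rightarrow> real \<Rightarrow> (real ^ 'n \<Rightarrow> real ^ 'n) \<Rightarrow> bool" where
  "quasi_homogeneous \<alpha> k F \<longleftrightarrow>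
     (\<forall>x s i. s > 0 \<longrightarrow> F (qscale \<alpha> s *v x) $ i = s powr (k + real (\<alpha> i)) * F x $ i)"

definition asymp_quasi_homogeneous ::
  "('n::finite \<Rightarrow> nat) \<Rightarrow> real \<Rightarrow> (real ^ 'n \<Rightarrow> real ^ 'n) \<Rightarrow> (real ^ 'n \<Rightarrow> real ^ 'n) \<Rightarrow> bool" where
  "asymp_quasi_homogeneous \<alpha> k f F \<longleftrightarrow>
     quasi_homogeneous \<alpha> k F \<and>
     (\<forall>i. uniform_limit (sphere 0 1)
        (\<lambda>s x. (f (qscale \<alpha> s *v x) $ i - s powr (k + real (\<alpha> i)) * F x $ i)
                / s powr (k + real (\<alpha> i)))
        (\<lambda>x. 0) at_top)"

definition qlcm :: "('n \<Rightarrow> nat) \<Rightarrow> nat" where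
  "qlcm \<alpha> = Lcm (range \<alpha>)"

definition qbeta :: "('n \<Rightarrow> nat) \<Rightarrow> 'n \<Rightarrow> nat" where
  "qbeta \<alpha> i = qlcm \<alpha> div \<alpha> i"

definition qp :: "('n::finite \<Rightarrow> nat) \<Rightarrow> real ^ 'n \<Rightarrow> real" where
  "qp \<alpha> x = root (2 * qlcm \<alpha>) (\<Sum>i\<in>UNIV. (x $ i) ^ (2 * qbeta \<alpha> i))"

definition qdisk :: "('n::finite \<Rightarrow> nat) \<Rightarrow> (real ^ 'n) set" where
  "qdisk \<alpha> = {x. qp \<alpha> x < 1}"

definition horizon :: "('n::finite \<Rightarrow> nat) \<Rightarrow> (real ^ 'n) set" where
  "horizon \<alpha> = {x. qp \<alpha> x = 1}"

text \<open>The filter of points of the disk approaching the horizon: \<open>p\<close> tends to 1 from below.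
  The horizon being compact, this is the same as the distance to the horizon tending to 0
  inside the disk.\<close>

definition to_horizon :: "('n::finite \<Rightarrow> nat) \<Rightarrow> (real ^ 'n) filter" where
  "to_horizon \<alpha> = filtercomap (qp \<alpha>) (at_left 1)"

definition qkappa :: "('n::finite \<Rightarrow> nat) \<Rightarrow> real ^ 'n \<Rightarrow> real" where
  "qkappa \<alpha> x = inverse (1 - qp \<alpha> x ^ (2 * qlcm \<alpha>))"

text \<open>The rescaling \<open>f \<mapsto> f~\<close> (applied to \<open>f\<close> and to its residual part); only its values on the
  open disk are meaningful.\<close>

definition qtilde ::
  "('n::finite \<Rightarrow> nat) \<Rightarrow> real \<Rightarrow> (real ^ 'n \<Rightarrow> real ^ 'n) \<Rightarrow> real ^ 'n \<Rightarrow> real ^ 'n" where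
  "qtilde \<alpha> k f x =
     (\<chi> i. qkappa \<alpha> x powr (- (k + real (\<alpha> i))) * f (qscale \<alpha> (qkappa \<alpha> x) *v x) $ i)"

text \<open>In the following, \<open>F\<close> is the quasi-homogeneous part of \<open>f\<close>; it provides the values on the
  horizon. Values outside the closed disk are irrelevant.\<close>

definition qtilde_ext ::
  "('n::finite \<Rightarrow> nat) \<Rightarrow> real \<Rightarrow> (real ^ 'n \<Rightarrow> real ^ 'n) \<Rightarrow> (real ^ 'n \<Rightarrow> real ^ 'n)
    \<Rightarrow> real ^ 'n \<Rightarrow> real ^ 'n" where
  "qtilde_ext \<alpha> k f F x = (if x \<in> qdisk \<alpha> then qtilde \<alpha> k f x else F x)"

definition G_fun ::
  "('n::finite \<Rightarrow> nat) \<Rightarrow> real \<Rightarrow> (real ^ 'n \<Rightarrow> real ^ 'n) \<Rightarrow> (real ^ 'n \<Rightarrow> real ^ 'n)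
    \<Rightarrow> real ^ 'n \<Rightarrow> real" where
  "G_fun \<alpha> k f F x =
     (\<Sum>j\<in>UNIV. (x $ j) ^ (2 * qbeta \<alpha> j - 1) / real (\<alpha> j) * qtilde_ext \<alpha> k f F x $ j)"

definition desing ::
  "('n::finite \<Rightarrow> nat) \<Rightarrow> real \<Rightarrow> (real ^ 'n \<Rightarrow> real ^ 'n) \<Rightarrow> (real ^ 'n \<Rightarrow> real ^ 'n)
    \<Rightarrow> real ^ 'n \<Rightarrow> real ^ 'n" where
  "desing \<alpha> k f F x =
     (1 - (2 * real (qlcm \<alpha>) - 1) / (2 * real (qlcm \<alpha>)) * (1 - qp \<alpha> x ^ (2 * qlcm \<alpha>)))
       *\<^sub>R qtilde_ext \<alpha> k f F x
     - G_fun \<alpha> k f F x *\<^sub>R (Lam \<alpha> *v x)"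

text \<open>Derivatives on the horizon are continuous extensions from the open disk. Since
  \<^const>\<open>jacobian\<close> and \<^const>\<open>Lim\<close> are total, the predicate \<open>has_jacobian_ext\<close>
  records that the extension really exists.\<close>

definition jacobian_ext ::
  "('n::finite \<Rightarrow> nat) \<Rightarrow> (real ^ 'n \<Rightarrow> real ^ 'n) \<Rightarrow> real ^ 'n \<Rightarrow> real ^ 'n ^ 'n" where
  "jacobian_ext \<alpha> h x = Lim (at x within qdisk \<alpha>) (\<lambda>y. jacobian h (at y))"

definition has_jacobian_ext ::
  "('n::finite \<Rightarrow> nat) \<Rightarrow> (real ^ 'n \<Rightarrow> real ^ 'n) \<Rightarrow> real ^ 'n \<Rightarrow> bool" where
  "has_jacobian_ext \<alpha> h x \<longleftrightarrow>
     (\<forall>y \<in> qdisk \<alpha>. h differentiable (at y)) \<and>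
     ((\<lambda>y. jacobian h (at y)) \<longlongrightarrow> jacobian_ext \<alpha> h x) (at x within qdisk \<alpha>)"

end

theory Submission
  imports Defs
begin

text \<open>On the open disk, quasi-homogeneity turns the rescaled field into \<open>F + R\<close>, where \<open>R\<close> is the
  rescaled residual part. Both \<open>R\<close> and its derivative vanish at the horizon, so the
  Jacobian of \<open>g\<close> extends continuously and its value at \<open>x\<close> is that of the field built from
  \<open>F\<close> alone. There Euler's identity \<open>D F\<^sub>i(x) (\<Lambda> x) = (k + \<alpha>\<^sub>i) F\<^sub>i(x)\<close>, its analogues for
  \<open>p\<^sup>2\<^sup>c\<close> and \<open>G\<close> (of weights \<open>2c\<close> and \<open>2c + k\<close>), and the equilibrium equation
  \<open>F(x) = C \<Lambda> x\<close> give
  \<open>D g(x) (\<Lambda> x) = (2c - 1) C \<Lambda> x + C (k + \<Lambda>) \<Lambda> x - (2c + k) C \<Lambda> x - C \<Lambda>\<^sup>2 x = - C \<Lambda> x\<close>.\<close>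

section \<open>Diagonal scalings and the polynomial \<open>p^(2c)\<close>\<close>

lemma diag_matrix_mult_vec [simp]:
  fixes y :: "real ^ 'n::finite"
  shows "(diag_matrix d *v y) $ i = d i * y $ i"
proof -
  have "(\<Sum>j\<in>UNIV. (if i = j then d i else 0) * y $ j) = (\<Sum>j\<in>UNIV. if i = j then d i * y $ j else 0)"
    by (rule sum.cong) auto
  then show ?thesis by (simp add: diag_matrix_def matrix_vector_mult_def)
qed

lemma qscale_eq:
  fixes y :: "real ^ 'n::finite"
  shows "qscale \<alpha> s *v y = (\<chi> i. s ^ \<alpha> i * y $ i)"
  by (simp add: vec_eq_iff qscale_def)

lemma Lam_mult_vec [simp]:
  fixes y :: "real ^ 'n::finite"
  shows "(Lam \<alpha> *v y) $ i = real (\<alpha> i) * y $ i"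
  by (simp add: Lam_def)

text \<open>This is \<open>p^(2c)\<close> with the root removed: a polynomial, hence smooth
  everywhere, which describes disk, horizon and \<open>qkappa\<close> equally well.\<close>

definition qpoly :: "('n::finite \<Rightarrow> nat) \<Rightarrow> real ^ 'n \<Rightarrow> real" where
  "qpoly \<alpha> y = (\<Sum>i\<in>UNIV. (y $ i) ^ (2 * qbeta \<alpha> i))"

lemma qpoly_nonneg: "0 \<le> qpoly \<alpha> y"
  by (simp add: qpoly_def sum_nonneg)

lemma has_derivative_qpoly:
  "(qpoly \<alpha> has_derivative
     (\<lambda>v. \<Sum>i\<in>UNIV. real (2 * qbeta \<alpha> i) * (y $ i) ^ (2 * qbeta \<alpha> i - 1) * v $ i)) (at y)"
proof -
  have "((\<lambda>y. (y $ i) ^ (2 * qbeta \<alpha> i)) has_derivative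
      (\<lambda>v. real (2 * qbeta \<alpha> i) * (y $ i) ^ (2 * qbeta \<alpha> i - 1) * v $ i)) (at y)" for i
    by (rule has_derivative_eq_rhs[OF has_derivative_power[OF
          bounded_linear_imp_has_derivative[OF bounded_linear_vec_nth]]]) (simp add: fun_eq_iff)
  then show ?thesis
    unfolding qpoly_def[abs_def] by (rule has_derivative_sum)
qed

lemma continuous_on_qpoly: "continuous_on S (qpoly \<alpha>)"
  unfolding qpoly_def by (intro continuous_intros)

text \<open>The map sending \<open>f~\<close> to \<open>g\<close>; its derivative at \<open>y\<close> depends only on the value \<open>t\<close> and the
  derivative \<open>u\<close> of \<open>f~\<close> at \<open>y\<close>.\<close>

definition desing_op ::
  "('n::finite \<Rightarrow> nat) \<Rightarrow> (real ^ 'n \<Rightarrow> real ^ 'n) \<Rightarrow> real ^ 'n \<Rightarrow> real ^ 'n" where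
  "desing_op \<alpha> T y =
     (1 - (2 * real (qlcm \<alpha>) - 1) / (2 * real (qlcm \<alpha>)) * (1 - qpoly \<alpha> y)) *\<^sub>R T y
     - (\<Sum>j\<in>UNIV. (y $ j) ^ (2 * qbeta \<alpha> j - 1) / real (\<alpha> j) * T y $ j) *\<^sub>R (Lam \<alpha> *v y)"

definition desing_op_deriv ::
  "('n::finite \<Rightarrow> nat) \<Rightarrow> real ^ 'n \<Rightarrow> real ^ 'n \<Rightarrow> (real ^ 'n \<Rightarrow> real ^ 'n) \<Rightarrow> real ^ 'n \<Rightarrow> real ^ 'n" where
  "desing_op_deriv \<alpha> y t u v =
     ((2 * real (qlcm \<alpha>) - 1) / (2 * real (qlcm \<alpha>))
        * (\<Sum>i\<in>UNIV. real (2 * qbeta \<alpha> i) * (y $ i) ^ (2 * qbeta \<alpha> i - 1) * v $ i)) *\<^sub>R t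
     + (1 - (2 * real (qlcm \<alpha>) - 1) / (2 * real (qlcm \<alpha>)) * (1 - qpoly \<alpha> y)) *\<^sub>R u v
     - ((\<Sum>j\<in>UNIV. real (2 * qbeta \<alpha> j - 1) * (y $ j) ^ (2 * qbeta \<alpha> j - 1 - 1) * v $ j
              / real (\<alpha> j) * t $ j
            + (y $ j) ^ (2 * qbeta \<alpha> j - 1) / real (\<alpha> j) * u v $ j) *\<^sub>R (Lam \<alpha> *v y)
        + (\<Sum>j\<in>UNIV. (y $ j) ^ (2 * qbeta \<alpha> j - 1) / real (\<alpha> j) * t $ j) *\<^sub>R (Lam \<alpha> *v v))"

lemma has_derivative_desing_op:
  assumes T: "(T has_derivative u) (at y)"
  shows "(desing_op \<alpha> T has_derivative desing_op_deriv \<alpha> y (T y) u) (at y)"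
proof -
  let ?a = "(2 * real (qlcm \<alpha>) - 1) / (2 * real (qlcm \<alpha>))"
  let ?P' = "\<lambda>v. \<Sum>i\<in>UNIV. real (2 * qbeta \<alpha> i) * (y $ i) ^ (2 * qbeta \<alpha> i - 1) * v $ i"
  let ?w = "\<lambda>y j. (y $ j) ^ (2 * qbeta \<alpha> j - 1) / real (\<alpha> j)"
  let ?w' = "\<lambda>j v. real (2 * qbeta \<alpha> j - 1) * (y $ j) ^ (2 * qbeta \<alpha> j - 1 - 1) * v $ j / real (\<alpha> j)"
  have c: "((\<lambda>y. 1 - ?a * (1 - qpoly \<alpha> y)) has_derivative (\<lambda>v. ?a * ?P' v)) (at y)"
    by (rule derivative_eq_intros has_derivative_qpoly refl)+ (simp add: fun_eq_iff)
  have "((\<lambda>y. ?w y j) has_derivative ?w' j) (at y)" for j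
    by (rule has_derivative_eq_rhs[OF bounded_linear.has_derivative[OF bounded_linear_divide
          has_derivative_power[OF bounded_linear_imp_has_derivative[OF bounded_linear_vec_nth]]]])
      (simp add: fun_eq_iff)
  moreover have "((\<lambda>y. T y $ j) has_derivative (\<lambda>v. u v $ j)) (at y)" for j
    using T by (rule bounded_linear.has_derivative[OF bounded_linear_vec_nth])
  ultimately have "((\<lambda>y. ?w y j * T y $ j) has_derivative
      (\<lambda>v. ?w y j * u v $ j + ?w' j v * T y $ j)) (at y)" for j
    by (rule has_derivative_mult)
  then have s: "((\<lambda>y. \<Sum>j\<in>UNIV. ?w y j * T y $ j) has_derivative
      (\<lambda>v. \<Sum>j\<in>UNIV. ?w y j * u v $ j + ?w' j v * T y $ j)) (at y)"
    by (rule has_derivative_sum)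
  have l: "((\<lambda>y. Lam \<alpha> *v y) has_derivative (\<lambda>v. Lam \<alpha> *v v)) (at y)"
    by (rule bounded_linear_imp_has_derivative[OF matrix_vector_mul_bounded_linear])
  show ?thesis
    unfolding desing_op_def[abs_def]
    by (rule has_derivative_eq_rhs[OF has_derivative_diff[OF has_derivative_scaleR[OF c T]
          has_derivative_scaleR[OF s l]]])
      (simp add: fun_eq_iff desing_op_deriv_def add.commute)
qed

text \<open>For fixed \<open>v\<close> the expression is polynomial in the components of
  \<open>y\<close>, \<open>t y\<close> and \<open>u y v\<close>, so pointwise convergence of the
  derivatives in the direction \<open>v\<close> suffices.\<close>

lemma tendsto_desing_op_deriv:
  assumes t: "(t \<longlongrightarrow> t0) (at x within S)"
    and u: "((\<lambda>y. u y v) \<longlongrightarrow> u0 v) (at x within S)"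
  shows "((\<lambda>y. desing_op_deriv \<alpha> y (t y) (u y) v) \<longlongrightarrow> desing_op_deriv \<alpha> x t0 u0 v) (at x within S)"
proof -
  have P: "(qpoly \<alpha> \<longlongrightarrow> qpoly \<alpha> x) (at x within S)"
    using continuous_on_qpoly[of UNIV \<alpha>]
    by (simp add: continuous_on_eq_continuous_within continuous_within tendsto_within_subset[OF _ subset_UNIV])
  have L: "((\<lambda>y. Lam \<alpha> *v y) \<longlongrightarrow> Lam \<alpha> *v x) (at x within S)"
    by (rule bounded_linear.tendsto[OF matrix_vector_mul_bounded_linear tendsto_ident_at])
  show ?thesis
    unfolding desing_op_deriv_def divide_inverse
    by (intro tendsto_intros P L t u)
qed

section \<open>Limits of Jacobians, differentiability and Euler's identity\<close>

text \<open>The columns of a Jacobian are the derivatives along the axis vectors, so convergence in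
  each fixed direction gives convergence of the matrix.\<close>

lemma tendsto_jacobian:
  fixes h :: "real ^ 'n::finite \<Rightarrow> real ^ 'm::finite"
  assumes deriv: "\<And>y. y \<in> S \<Longrightarrow> (h has_derivative h' y) (at y)"
    and lim: "\<And>v. ((\<lambda>y. h' y v) \<longlongrightarrow> D v) (at x within S)"
  shows "((\<lambda>y. jacobian h (at y)) \<longlongrightarrow> matrix D) (at x within S)"
proof -
  have "jacobian h (at y) = matrix (h' y)" if "y \<in> S" for y
    using frechet_derivative_at[OF deriv[OF that]] by (simp add: jacobian_def)
  then have ev: "\<forall>\<^sub>F y in at x within S. matrix (h' y) = jacobian h (at y)"
    by (simp add: eventually_at_filter)
  have "((\<lambda>y. matrix (h' y)) \<longlongrightarrow> matrix D) (at x within S)"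
    unfolding matrix_def by (intro vec_tendstoI) (simp add: tendsto_vec_nth[OF lim])
  then show ?thesis
    using ev by (rule Lim_transform_eventually)
qed

lemma Ck_imp_differentiable: "Ck r f \<Longrightarrow> r > 0 \<Longrightarrow> f differentiable (at x)"
  by (cases r) auto

lemma differentiable_vecI:
  fixes h :: "real ^ 'n::finite \<Rightarrow> real ^ 'm::finite"
  assumes "\<And>i. (\<lambda>y. h y $ i) differentiable (at x)"
  shows "h differentiable (at x)"
  by (subst differentiable_componentwise_within) (auto simp: Basis_vec_def inner_axis assms)

text \<open>The curve \<open>F (qscale \<alpha> s *v x)\<close> is differentiated at
  \<open>s = 1\<close> twice: by the chain rule, the inner curve having velocity
  \<open>Lam \<alpha> *v x\<close>, and as a multiple of a power of \<open>s\<close>. Uniqueness of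
  the derivative equates the results.\<close>

lemma quasi_homogeneous_Euler:
  fixes F :: "real ^ 'n::finite \<Rightarrow> real ^ 'n"
  assumes qh: "quasi_homogeneous \<alpha> k F" and F: "(F has_derivative F') (at x)"
  shows "F' (Lam \<alpha> *v x) $ i = (k + real (\<alpha> i)) * F x $ i"
proof -
  have "((\<lambda>s. s ^ \<alpha> j * x $ j) has_derivative (\<lambda>h. h * (real (\<alpha> j) * x $ j))) (at 1)" for j
    by (auto intro!: derivative_eq_intros)
  then have "((\<lambda>s. qscale \<alpha> s *v x) has_derivative (\<lambda>h. h *\<^sub>R (Lam \<alpha> *v x))) (at 1)"
    unfolding qscale_eq by (subst has_derivative_componentwise_within)
      (auto simp: Basis_vec_def inner_axis)
  moreover have "(F has_derivative F') (at (qscale \<alpha> 1 *v x))"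
    using F by (simp add: qscale_eq)
  ultimately have "((\<lambda>s. F (qscale \<alpha> s *v x)) has_derivative (\<lambda>h. F' (h *\<^sub>R (Lam \<alpha> *v x)))) (at 1)"
    by (rule has_derivative_compose)
  then have "((\<lambda>s. F (qscale \<alpha> s *v x) $ i) has_derivative (\<lambda>h. F' (h *\<^sub>R (Lam \<alpha> *v x)) $ i)) (at 1)"
    by (rule bounded_linear.has_derivative[OF bounded_linear_vec_nth])
  \<comment> \<open>The scaling law is available for \<open>s > 0\<close> only, which is an open set
    around 1.\<close>
  then have 1: "((\<lambda>s. s powr (k + real (\<alpha> i)) * F x $ i) has_derivative
      (\<lambda>h. F' (h *\<^sub>R (Lam \<alpha> *v x)) $ i)) (at 1)"
    by (rule has_derivative_transform_within_open[where s = "{0<..}"])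
      (use qh in \<open>auto simp: quasi_homogeneous_def\<close>)
  have 2: "((\<lambda>s. s powr (k + real (\<alpha> i)) * F x $ i) has_derivative
      (\<lambda>h. h * ((k + real (\<alpha> i)) * F x $ i))) (at 1)"
    by (auto intro!: derivative_eq_intros)
  show ?thesis
    using fun_cong[OF has_derivative_unique[OF 1 2], of 1] by simp
qed

section \<open>The disk, the horizon and the rescaled field\<close>

context
  fixes \<alpha> :: "'n::finite \<Rightarrow> nat"
  assumes alpha_pos: "\<And>i. \<alpha> i > 0"
begin

lemma qlcm_pos: "qlcm \<alpha> > 0"
  unfolding qlcm_def using alpha_pos by (auto simp: Lcm_0_iff image_iff intro!: Nat.gr0I) (metis less_irrefl)

text \<open>Each \<open>\<alpha> i\<close> divides the least common multiple, so the integer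
  division in \<open>qbeta\<close> is exact.\<close>

lemma qbeta_mult: "qbeta \<alpha> i * \<alpha> i = qlcm \<alpha>"
  unfolding qbeta_def qlcm_def by (rule dvd_div_mult_self) (auto intro: dvd_Lcm)

lemma qbeta_pos: "qbeta \<alpha> i > 0"
  using qbeta_mult[of i] qlcm_pos by (cases "qbeta \<alpha> i") auto

lemma qp_power: "qp \<alpha> y ^ (2 * qlcm \<alpha>) = qpoly \<alpha> y"
  using qlcm_pos qpoly_nonneg[of \<alpha> y] by (simp add: qp_def qpoly_def)

lemma qdisk_eq: "qdisk \<alpha> = {y. qpoly \<alpha> y < 1}"
  using qlcm_pos by (auto simp: qdisk_def qp_def qpoly_def)

lemma horizon_eq: "horizon \<alpha> = {y. qpoly \<alpha> y = 1}"
  using qlcm_pos by (auto simp: horizon_def qp_def qpoly_def)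

lemma open_qdisk: "open (qdisk \<alpha>)"
  unfolding qdisk_eq by (intro open_Collect_less continuous_on_qpoly continuous_on_const)

lemma qkappa_eq: "qkappa \<alpha> y = inverse (1 - qpoly \<alpha> y)"
  by (simp add: qkappa_def qp_power)

lemma qkappa_pos: "y \<in> qdisk \<alpha> \<Longrightarrow> qkappa \<alpha> y > 0"
  by (simp add: qkappa_eq qdisk_eq)

lemma qkappa_differentiable: "y \<in> qdisk \<alpha> \<Longrightarrow> qkappa \<alpha> differentiable (at y)"
  using has_derivative_qpoly[of \<alpha> y] unfolding qkappa_eq[abs_def] qdisk_eq
  by (intro derivative_intros) (auto simp: differentiable_def)

lemma qtilde_differentiable:
  assumes y: "y \<in> qdisk \<alpha>" and f: "\<And>z. f differentiable (at z)"
  shows "qtilde \<alpha> k f differentiable (at y)"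
proof (rule differentiable_vecI)
  fix i
  have "(\<lambda>y. qscale \<alpha> (qkappa \<alpha> y) *v y) differentiable (at y)"
    unfolding qscale_eq
    by (rule differentiable_vecI)
      (simp add: qkappa_differentiable[OF y] bounded_linear_imp_differentiable bounded_linear_vec_nth)
  then have "(\<lambda>y. f (qscale \<alpha> (qkappa \<alpha> y) *v y)) differentiable (at y)"
    using f by (rule differentiable_compose[rotated])
  then have "(\<lambda>y. f (qscale \<alpha> (qkappa \<alpha> y) *v y) $ i) differentiable (at y)"
    by (rule differentiable_compose[OF bounded_linear_imp_differentiable[OF bounded_linear_vec_nth]])
  \<comment> \<open>The derivative of \<open>powr\<close> is taken at a positive base, which
    \<open>qkappa\<close> provides inside the disk.\<close>
  moreover have "(\<lambda>t. t powr (- (k + real (\<alpha> i)))) differentiable (at (qkappa \<alpha> y))"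
    using qkappa_pos[OF y] has_real_derivative_powr real_differentiable_def by blast
  then have "(\<lambda>y. qkappa \<alpha> y powr (- (k + real (\<alpha> i)))) differentiable (at y)"
    using qkappa_differentiable[OF y] by (rule differentiable_compose)
  ultimately show "(\<lambda>y. qtilde \<alpha> k f y $ i) differentiable (at y)"
    by (simp add: qtilde_def)
qed

text \<open>Quasi-homogeneity with \<open>s = qkappa \<alpha> y\<close> cancels the prefactor, so
  rescaling leaves \<open>F\<close> unchanged; rescaling is also additive in the field.\<close>

lemma qtilde_decompose:
  assumes "quasi_homogeneous \<alpha> k F" "y \<in> qdisk \<alpha>"
  shows "qtilde \<alpha> k f y = F y + qtilde \<alpha> k (\<lambda>z. f z - F z) y"
proof -
  have "qkappa \<alpha> y powr (- (k + real (\<alpha> i))) * F (qscale \<alpha> (qkappa \<alpha> y) *v y) $ i = F y $ i" for i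
    using assms qkappa_pos[OF assms(2)]
    by (simp add: quasi_homogeneous_def powr_minus del: minus_add_distrib)
  then show ?thesis
    by (simp add: qtilde_def vec_eq_iff right_diff_distrib)
qed

lemma desing_eq_desing_op:
  "desing \<alpha> k f F y = desing_op \<alpha> (qtilde_ext \<alpha> k f F) y"
  by (simp add: desing_def desing_op_def G_fun_def qp_power)

section \<open>Approaching a point of the horizon from the disk\<close>

text \<open>The segment from the origin to \<open>x\<close> lies in the disk up to its endpoint, so
  \<open>x\<close> is a limit point. This makes limits at \<open>x\<close> unique, as needed to
  evaluate \<open>Lim\<close> in \<open>jacobian_ext\<close>.\<close>

lemma horizon_at_within_qdisk:
  assumes x: "x \<in> horizon \<alpha>"
  shows "at x within qdisk \<alpha> \<noteq> bot"
proof -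
  have Px: "qpoly \<alpha> x = 1" using x by (simp add: horizon_eq)
  have in_disk: "s *\<^sub>R x \<in> qdisk \<alpha>" if s: "0 < s" "s < 1" for s
  proof -
    have "qpoly \<alpha> (s *\<^sub>R x) \<le> (\<Sum>i\<in>UNIV. s * (x $ i) ^ (2 * qbeta \<alpha> i))"
      unfolding qpoly_def
    proof (rule sum_mono)
      fix i
      \<comment> \<open>Since \<open>2 * qbeta \<alpha> i\<close> is at least 1, every monomial
        shrinks at least by the factor \<open>s\<close>.\<close>
      have "s ^ (2 * qbeta \<alpha> i) \<le> s ^ 1"
        using s qbeta_pos[of i] by (intro power_decreasing) auto
      then show "((s *\<^sub>R x) $ i) ^ (2 * qbeta \<alpha> i) \<le> s * (x $ i) ^ (2 * qbeta \<alpha> i)"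
        by (simp add: power_mult_distrib mult_right_mono)
    qed
    also have "\<dots> = s * qpoly \<alpha> x" by (simp add: qpoly_def sum_distrib_left)
    finally show ?thesis using s Px by (simp add: qdisk_eq)
  qed
  have "((\<lambda>s. s *\<^sub>R x) \<longlongrightarrow> 1 *\<^sub>R x) (at_left (1::real))"
    by (intro tendsto_intros)
  moreover have "\<forall>\<^sub>F s in at_left (1::real). s *\<^sub>R x \<in> closure (qdisk \<alpha>)"
    using eventually_at_left_real[of 0 1, OF zero_less_one]
    by eventually_elim (use in_disk closure_subset in auto)
  ultimately have "1 *\<^sub>R x \<in> closure (qdisk \<alpha>)"
    by (intro Lim_in_closed_set[OF closed_closure _ trivial_limit_at_left_real])
  \<comment> \<open>As \<open>x\<close> itself is outside the open disk, membership in the closure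
    means being a limit point.\<close>
  then show ?thesis
    using Px by (auto simp: closure_def qdisk_eq trivial_limit_within)
qed

text \<open>By continuity \<open>qp\<close> tends to 1 at \<open>x\<close>, and from below inside
  the disk. Estimates along the whole horizon thus become estimates at the single point
  \<open>x\<close>.\<close>

lemma at_within_qdisk_le_to_horizon:
  assumes x: "x \<in> horizon \<alpha>"
  shows "at x within qdisk \<alpha> \<le> to_horizon \<alpha>"
proof -
  have "(qp \<alpha> \<longlongrightarrow> qp \<alpha> x) (at x within qdisk \<alpha>)"
    unfolding qp_def by (intro tendsto_intros)
  then have "filterlim (qp \<alpha>) (at_left 1) (at x within qdisk \<alpha>)"
    using x by (auto simp: filterlim_at horizon_def qdisk_def eventually_at_filter)
  then show ?thesis
    by (simp add: to_horizon_def filterlim_def filtermap_le_iff_le_filtercomap)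
qed

text \<open>\<open>1 - qpoly\<close> tends to 0 through positive values, so \<open>qkappa\<close>
  tends to infinity and its negative powers to 0.\<close>

lemma qkappa_powr_tendsto_0:
  assumes x: "x \<in> horizon \<alpha>" and e: "e < 0"
  shows "((\<lambda>y. qkappa \<alpha> y powr e) \<longlongrightarrow> 0) (at x within qdisk \<alpha>)"
proof -
  have "((\<lambda>y. 1 - qpoly \<alpha> y) \<longlongrightarrow> 1 - qpoly \<alpha> x) (at x within qdisk \<alpha>)"
    unfolding qpoly_def by (intro tendsto_intros)
  moreover have "\<forall>\<^sub>F y in at x within qdisk \<alpha>. 0 < 1 - qpoly \<alpha> y"
    by (simp add: eventually_at_filter qdisk_eq)
  ultimately have "filterlim (qkappa \<alpha>) at_top (at x within qdisk \<alpha>)"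
    unfolding qkappa_eq[abs_def] using x by (intro filterlim_inverse_at_top) (simp_all add: horizon_eq)
  then show ?thesis by (rule tendsto_neg_powr[OF e])
qed

section \<open>Continuous extension of the Jacobian to the horizon\<close>

text \<open>At disk points the derivative formula applies with value \<open>F + R\<close> and
  derivative \<open>F' + DR\<close>; both arguments converge at \<open>x\<close>, to
  \<open>F x\<close> and \<open>F' x\<close>, and the formula is continuous in them.\<close>

lemma has_jacobian_ext_desing:
  fixes F' :: "real ^ 'n \<Rightarrow> real ^ 'n \<Rightarrow> real ^ 'n"
  assumes qh: "quasi_homogeneous \<alpha> k F"
    and f: "\<And>z. f differentiable (at z)"
    and F: "\<And>z. (F has_derivative F' z) (at z)"
    and F'_cont: "\<And>v. isCont (\<lambda>z. F' z v) x"
    and x: "x \<in> horizon \<alpha>"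
    and R: "\<And>i. ((\<lambda>y. qtilde \<alpha> k (\<lambda>z. f z - F z) y $ i) \<longlongrightarrow> 0) (at x within qdisk \<alpha>)"
    and DR: "\<And>i l. ((\<lambda>y. jacobian (qtilde \<alpha> k (\<lambda>z. f z - F z)) (at y) $ i $ l) \<longlongrightarrow> 0)
              (at x within qdisk \<alpha>)"
  shows "has_jacobian_ext \<alpha> (desing \<alpha> k f F) x"
    and "jacobian_ext \<alpha> (desing \<alpha> k f F) x = matrix (desing_op_deriv \<alpha> x (F x) (F' x))"
proof -
  let ?R = "qtilde \<alpha> k (\<lambda>z. f z - F z)"
  let ?u = "\<lambda>y v. F' y v + jacobian ?R (at y) *v v"
  have deriv: "(desing \<alpha> k f F has_derivative desing_op_deriv \<alpha> y (F y + ?R y) (?u y)) (at y)"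
    if y: "y \<in> qdisk \<alpha>" for y
  proof -
    have "?R differentiable (at y)"
      using f F by (intro qtilde_differentiable y derivative_intros) (auto simp: differentiable_def)
    then have "((\<lambda>y. F y + ?R y) has_derivative ?u y) (at y)"
      by (intro has_derivative_add F) (simp add: jacobian_works)
    then have "(desing_op \<alpha> (\<lambda>y. F y + ?R y) has_derivative
        desing_op_deriv \<alpha> y (F y + ?R y) (?u y)) (at y)"
      by (rule has_derivative_desing_op)
    \<comment> \<open>\<open>desing\<close> agrees with \<open>desing_op\<close> applied to
      \<open>F + R\<close> throughout the open disk, so the derivative carries over.\<close>
    then show ?thesis
      by (rule has_derivative_transform_within_open[OF _ open_qdisk y])
        (simp add: desing_eq_desing_op desing_op_def qtilde_ext_def flip: qtilde_decompose[OF qh])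
  qed
  have Fx: "(F \<longlongrightarrow> F x) (at x within qdisk \<alpha>)"
    using has_derivative_continuous[OF F] by (meson continuous_within tendsto_within_subset subset_UNIV)
  have "(?R \<longlongrightarrow> 0) (at x within qdisk \<alpha>)"
    by (intro vec_tendstoI) (simp add: R)
  from tendsto_add[OF Fx this] have t: "((\<lambda>y. F y + ?R y) \<longlongrightarrow> F x) (at x within qdisk \<alpha>)"
    by simp
  have u: "((\<lambda>y. ?u y v) \<longlongrightarrow> F' x v) (at x within qdisk \<alpha>)" for v
  proof -
    have "((\<lambda>y. \<Sum>l\<in>UNIV. jacobian ?R (at y) $ i $ l * v $ l) \<longlongrightarrow> (\<Sum>l\<in>UNIV. 0 * v $ l))
        (at x within qdisk \<alpha>)" for i
      by (intro tendsto_intros DR)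
    then have "((\<lambda>y. jacobian ?R (at y) *v v) \<longlongrightarrow> 0) (at x within qdisk \<alpha>)"
      by (intro vec_tendstoI) (simp add: matrix_vector_mult_def)
    moreover have "((\<lambda>y. F' y v) \<longlongrightarrow> F' x v) (at x within qdisk \<alpha>)"
      using F'_cont by (meson continuous_within tendsto_within_subset subset_UNIV)
    ultimately show ?thesis using tendsto_add by fastforce
  qed
  have lim: "((\<lambda>y. jacobian (desing \<alpha> k f F) (at y)) \<longlongrightarrow> matrix (desing_op_deriv \<alpha> x (F x) (F' x)))
      (at x within qdisk \<alpha>)"
    by (rule tendsto_jacobian[OF deriv]) (auto intro: tendsto_desing_op_deriv t u)
  \<comment> \<open>Nontriviality of the filter turns convergence into the value of
    \<open>Lim\<close>.\<close>
  then show eq: "jacobian_ext \<alpha> (desing \<alpha> k f F) x = matrix (desing_op_deriv \<alpha> x (F x) (F' x))"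
    unfolding jacobian_ext_def using horizon_at_within_qdisk[OF x] by (intro tendsto_Lim)
  show "has_jacobian_ext \<alpha> (desing \<alpha> k f F) x"
    using deriv lim eq by (auto simp: has_jacobian_ext_def differentiable_def)
qed

section \<open>The eigenvector computation at an equilibrium\<close>

lemma desing_op_deriv_equilibrium:
  assumes qh: "quasi_homogeneous \<alpha> k F" and F: "(F has_derivative F') (at x)"
    and x: "x \<in> horizon \<alpha>"
    and C: "C = (\<Sum>j\<in>UNIV. (x $ j) ^ (2 * qbeta \<alpha> j - 1) / real (\<alpha> j) * F x $ j)"
    and equilibrium: "F x = C *\<^sub>R (Lam \<alpha> *v x)"
  shows "desing_op_deriv \<alpha> x (F x) F' (Lam \<alpha> *v x) = - C *\<^sub>R (Lam \<alpha> *v x)"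
proof -
  let ?c = "real (qlcm \<alpha>)"
  have Px: "qpoly \<alpha> x = 1" using x by (simp add: horizon_eq)
  have c: "real (qbeta \<alpha> j) * real (\<alpha> j) = ?c" for j
    using qbeta_mult[of j] by (metis of_nat_mult)
  \<comment> \<open>Positivity of \<open>qbeta\<close> keeps both natural subtractions from
    truncating: \<open>2 * qbeta \<alpha> j - 1\<close> is at least 1.\<close>
  have pw: "(x $ j) ^ (2 * qbeta \<alpha> j - 1) * x $ j = (x $ j) ^ (2 * qbeta \<alpha> j)"
    "(x $ j) ^ (2 * qbeta \<alpha> j - 1 - 1) * x $ j = (x $ j) ^ (2 * qbeta \<alpha> j - 1)"
    "real (2 * qbeta \<alpha> j - 1) = 2 * real (qbeta \<alpha> j) - 1" for j
    using qbeta_pos[of j] power_minus_mult[of "2 * qbeta \<alpha> j" "x $ j"]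
      power_minus_mult[of "2 * qbeta \<alpha> j - 1" "x $ j"] by (auto simp: of_nat_diff)
  \<comment> \<open>Each monomial has weight \<open>2 * qbeta \<alpha> i * \<alpha> i\<close>, that
    is \<open>2c\<close>, and the monomials sum to 1 on the horizon.\<close>
  have P: "(\<Sum>i\<in>UNIV. real (2 * qbeta \<alpha> i) * (x $ i) ^ (2 * qbeta \<alpha> i - 1) * (Lam \<alpha> *v x) $ i) = 2 * ?c"
  proof -
    have "real (2 * qbeta \<alpha> i) * (x $ i) ^ (2 * qbeta \<alpha> i - 1) * (Lam \<alpha> *v x) $ i
        = 2 * ?c * (x $ i) ^ (2 * qbeta \<alpha> i)" for i
      unfolding c[of i, symmetric] pw(1)[symmetric] by simp
    then show ?thesis
      using Px by (simp only: qpoly_def mult_1_right flip: sum_distrib_left)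
  qed
  have Euler: "F' (Lam \<alpha> *v x) $ i = (k + real (\<alpha> i)) * F x $ i" for i
    by (rule quasi_homogeneous_Euler[OF qh F])
  \<comment> \<open>The monomial in front of \<open>F x $ j\<close> has weight
    \<open>2c - \<alpha> j\<close> and \<open>F x $ j\<close> has weight
    \<open>k + \<alpha> j\<close>; the exponents \<open>\<alpha> j\<close> cancel, so all summands
    share the weight \<open>2c + k\<close>.\<close>
  have G: "(\<Sum>j\<in>UNIV. real (2 * qbeta \<alpha> j - 1) * (x $ j) ^ (2 * qbeta \<alpha> j - 1 - 1) * (Lam \<alpha> *v x) $ j
              / real (\<alpha> j) * F x $ j
            + (x $ j) ^ (2 * qbeta \<alpha> j - 1) / real (\<alpha> j) * F' (Lam \<alpha> *v x) $ j) = (2 * ?c + k) * C"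
  proof -
    have "real (2 * qbeta \<alpha> j - 1) * (x $ j) ^ (2 * qbeta \<alpha> j - 1 - 1) * (Lam \<alpha> *v x) $ j
              / real (\<alpha> j) * F x $ j
            + (x $ j) ^ (2 * qbeta \<alpha> j - 1) / real (\<alpha> j) * F' (Lam \<alpha> *v x) $ j
          = (2 * ?c + k) * ((x $ j) ^ (2 * qbeta \<alpha> j - 1) / real (\<alpha> j) * F x $ j)" for j
    proof -
      have "real (2 * qbeta \<alpha> j - 1) * (x $ j) ^ (2 * qbeta \<alpha> j - 1 - 1) * (Lam \<alpha> *v x) $ j
          = real (\<alpha> j) * (real (2 * qbeta \<alpha> j - 1) * ((x $ j) ^ (2 * qbeta \<alpha> j - 1 - 1) * x $ j))"
        by simp
      also have "\<dots> = (2 * ?c - real (\<alpha> j)) * (x $ j) ^ (2 * qbeta \<alpha> j - 1)"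
        unfolding pw(2) c[of j, symmetric] unfolding pw(3) by (simp add: algebra_simps)
      finally have weight: "real (2 * qbeta \<alpha> j - 1) * (x $ j) ^ (2 * qbeta \<alpha> j - 1 - 1) * (Lam \<alpha> *v x) $ j
          = (2 * ?c - real (\<alpha> j)) * (x $ j) ^ (2 * qbeta \<alpha> j - 1)" .
      show ?thesis
        unfolding weight Euler using alpha_pos[of j] by (simp add: field_simps)
    qed
    then show ?thesis unfolding C by (simp add: sum_distrib_left)
  qed
  show ?thesis
  proof (rule vec_eq_iff[THEN iffD2], rule allI)
    fix i
    have c0: "?c > 0" using qlcm_pos by simp
    \<comment> \<open>The factor \<open>(2c - 1)/(2c)\<close> times the weight \<open>2c\<close>
      gives \<open>2c - 1\<close>, and the factor in front of the derivative of \<open>F\<close> is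
      1 because \<open>qpoly \<alpha> x = 1\<close>.\<close>
    have "desing_op_deriv \<alpha> x (F x) F' (Lam \<alpha> *v x) $ i
        = (2 * ?c - 1) * F x $ i + (k + real (\<alpha> i)) * F x $ i
          - ((2 * ?c + k) * C * (real (\<alpha> i) * x $ i) + C * (real (\<alpha> i) * (real (\<alpha> i) * x $ i)))"
      unfolding desing_op_deriv_def P G C[symmetric] Px
      using c0 by (simp add: Euler)
    \<comment> \<open>With \<open>F x\<close> replaced, every term is a multiple of
      \<open>C * \<alpha> i * x $ i\<close>, and
      \<open>(2c - 1) + (k + \<alpha> i) - (2c + k) - \<alpha> i = -1\<close>.\<close>
    also have "\<dots> = (- C *\<^sub>R (Lam \<alpha> *v x)) $ i"
      unfolding equilibrium by (simp add: algebra_simps)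
    finally show "desing_op_deriv \<alpha> x (F x) F' (Lam \<alpha> *v x) $ i = (- C *\<^sub>R (Lam \<alpha> *v x)) $ i" .
  qed
qed

end

section \<open>The eigenpair from the asymptotic hypotheses\<close>

theorem theorem3p11:
  fixes \<alpha> :: "'n::finite \<Rightarrow> nat" and k \<epsilon> :: real and r :: nat
    and f F :: "real ^ 'n \<Rightarrow> real ^ 'n" and x :: "real ^ 'n"
  assumes alpha_pos: "\<And>i. \<alpha> i > 0"
    and k_pos: "k > 0"
    and r_ge: "r \<ge> 2"
    and f_Cr: "Ck r f"
    and f_asymp: "asymp_quasi_homogeneous \<alpha> k f F"
    and F_C1: "Ck 1 F"
    and eps_pos: "\<epsilon> > 0"
    and res_bigo: "\<And>i. (\<lambda>y. qtilde \<alpha> k (\<lambda>z. f z - F z) y $ i)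
          \<in> O[to_horizon \<alpha>](\<lambda>y. qkappa \<alpha> y powr (- (1 + \<epsilon>)))"
    and res_deriv_smallo: "\<And>i l. (\<lambda>y. jacobian (qtilde \<alpha> k (\<lambda>z. f z - F z)) (at y) $ i $ l)
          \<in> o[to_horizon \<alpha>](\<lambda>y. qkappa \<alpha> y powr (- (1 + \<epsilon>)))"
    and x_horizon: "x \<in> horizon \<alpha>"
    and x_equilibrium: "desing \<alpha> k f F x = 0"
    and C_pos: "G_fun \<alpha> k f F x > 0"
  shows "has_jacobian_ext \<alpha> (desing \<alpha> k f F) x \<and>
    Lam \<alpha> *v x \<noteq> 0 \<and>
    jacobian_ext \<alpha> (desing \<alpha> k f F) x *v (Lam \<alpha> *v x)
      = (- G_fun \<alpha> k f F x) *\<^sub>R (Lam \<alpha> *v x)"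
proof -
  have qh: "quasi_homogeneous \<alpha> k F"
    using f_asymp by (simp add: asymp_quasi_homogeneous_def)
  have f: "f differentiable (at z)" for z
    using Ck_imp_differentiable[OF f_Cr] r_ge by simp
  define F' where "F' z = frechet_derivative F (at z)" for z
  have F: "(F has_derivative F' z) (at z)" for z
    unfolding F'_def using Ck_imp_differentiable[OF F_C1] by (simp add: frechet_derivative_works)
  \<comment> \<open>\<open>Ck 1\<close> provides continuity of the derivative in each fixed
    direction, which is the form the extension lemma asks for.\<close>
  have F'_cont: "isCont (\<lambda>z. F' z v) x" for v
    unfolding F'_def using F_C1 by (simp add: continuous_on_eq_continuous_at)
  \<comment> \<open>The exponent \<open>- (1 + \<epsilon>)\<close> is negative, so the bound tends
    to 0 at \<open>x\<close>. This serves the residual directly, and its derivative after weakening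
    little-o to big-O.\<close>
  have vanish: "(h \<longlongrightarrow> 0) (at x within qdisk \<alpha>)"
    if "h \<in> O[to_horizon \<alpha>](\<lambda>y. qkappa \<alpha> y powr (- (1 + \<epsilon>)))" for h :: "real ^ 'n \<Rightarrow> real"
  proof -
    have "h \<in> O[at x within qdisk \<alpha>](\<lambda>y. qkappa \<alpha> y powr (- (1 + \<epsilon>)))"
      using landau_o.big.filter_mono[OF at_within_qdisk_le_to_horizon[OF alpha_pos x_horizon] that] .
    moreover have "(\<lambda>y. qkappa \<alpha> y powr (- (1 + \<epsilon>))) \<in> o[at x within qdisk \<alpha>](\<lambda>_. 1)"
      using qkappa_powr_tendsto_0[OF alpha_pos x_horizon, of "- (1 + \<epsilon>)"] eps_pos
      by (intro smalloI_tendsto) simp_all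
    ultimately have "h \<in> o[at x within qdisk \<alpha>](\<lambda>_. 1)"
      by (rule landau_o.big_small_trans)
    then show ?thesis by (auto dest: smalloD_tendsto)
  qed
  note ext = has_jacobian_ext_desing[OF alpha_pos qh f F F'_cont x_horizon vanish[OF res_bigo]
      vanish[OF landau_o.small_imp_big[OF res_deriv_smallo]]]
  let ?C = "G_fun \<alpha> k f F x"
  have xF: "qtilde_ext \<alpha> k f F x = F x"
    using x_horizon by (simp add: qtilde_ext_def horizon_def qdisk_def)
  have C: "?C = (\<Sum>j\<in>UNIV. (x $ j) ^ (2 * qbeta \<alpha> j - 1) / real (\<alpha> j) * F x $ j)"
    by (simp add: G_fun_def xF)
  \<comment> \<open>On the horizon \<open>1 - p^(2c)\<close> vanishes, so the scalar in front of the
    rescaled field is 1.\<close>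
  have equilibrium: "F x = ?C *\<^sub>R (Lam \<alpha> *v x)"
    using x_equilibrium x_horizon by (simp add: desing_def xF horizon_def)
  have "jacobian_ext \<alpha> (desing \<alpha> k f F) x *v (Lam \<alpha> *v x)
      = desing_op_deriv \<alpha> x (F x) (F' x) (Lam \<alpha> *v x)"
    \<comment> \<open>Applying \<open>matrix\<close> of a map to a vector returns the value of the
      map once it is linear; linearity holds because the map is the derivative of
      \<open>desing_op \<alpha> F\<close> at \<open>x\<close>.\<close>
    unfolding ext(2)
    using has_derivative_linear[OF has_derivative_desing_op[OF F[of x]], of \<alpha>]
    by (simp add: matrix_works linear_matrix_vector_mul_eq)
  also have "\<dots> = (- ?C) *\<^sub>R (Lam \<alpha> *v x)"
    by (rule desing_op_deriv_equilibrium[OF alpha_pos qh F x_horizon C equilibrium])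
  finally have "jacobian_ext \<alpha> (desing \<alpha> k f F) x *v (Lam \<alpha> *v x) = (- ?C) *\<^sub>R (Lam \<alpha> *v x)" .
  \<comment> \<open>\<open>G_fun\<close> is linear in the value \<open>F x\<close>, so a zero vector
    here would make it vanish, against its positivity.\<close>
  moreover have "Lam \<alpha> *v x \<noteq> 0"
  proof
    assume "Lam \<alpha> *v x = 0"
    then have "F x = 0" using equilibrium by simp
    then show False using C C_pos by simp
  qed
  ultimately show ?thesis using ext(1) by blast
qed

end
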